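(* Let $k\ge 2$ be an integer. Let $D$ denote the steady-state sojourn time of an $M/G/1$ queue with arrival rate $\lambda>0$, service time $S$ with distribution function $F$, load $\rho=\lambda\mathbb{E}[S]<1$ and slack parameter $\varepsilon=1-\rho$, and let $Z\sim\mathrm{Exp}(\mu)$, $\mu>0$. Suppose that (i) the distribution of $S$ has a density $g$ with $\lim_{y\to\infty}g(y)=0$; (ii) $\int_0^\infty |y^k(g'(y)+\mu g(y))|\,dy$ is bounded by a constant $C_1$; (iii) $\mathbb{E}[S^i]=\mathbb{E}[Z^i]$ for all integers $i=1,2,\ldots,k+1$. Then $$\left|\mathbb{E}[(\varepsilon D)^k]-\frac{k!}{\mu^k}\right|\le C_2\,k!\,\varepsilon^k,\qquad C_2=\frac{1}{\mu\,k!}C_1+2\left(\sum_{j=1}^{2^{k-1}} b_{k,j}\int_0^\infty s^{d_{k,j}}\,dF(s)\right),$$ where the constants $b_{k,j}$ and $d_{k,j}$ are the explicit ones defined recursively in the context.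
   Context: $M/G/1$ queue: first-come-first-served single server with infinite buffer, Poisson arrivals of rate $\lambda$, i.i.d. nonnegative service times distributed as $S$ (independent of arrivals). $W$ is the steady-state waiting time (time in the system before service begins), and the sojourn time is the waiting time plus the task's own service time; in steady state $D=W+S$ in law, with $W$ and $S$ independent. The density $g$ is supported on $[0,\infty)$ and is differentiable on $(0,\infty)$. $\mathrm{Exp}(\mu)$ is the exponential distribution with mean $1/\mu$, so $\mathbb{E}[Z^i]=i!/\mu^i$. Constants: $b_{2,1}=\lambda/6$, $d_{2,1}=3$, $b_{2,2}=\lambda\mu/24$, $d_{2,2}=4$. For $k\ge3$: $b_{k,1}=\frac{\lambda\mu}{(k+2)!}$, $d_{k,1}=k+2$; $b_{k,2}=\frac{\lambda}{6\mu^{k-2}}$, $d_{k,2}=3$; and for $3\le r\le k$ and $1\le i\le 2^{r-2}$, $b_{k,2^{r-2}+i}=\frac{b_{r-1,i}}{\mu^{k-r+1}}$ and $d_{k,2^{r-2}+i}=d_{r-1,i}$. If one of the integrals in $C_2$ is infinite, $C_2=+\infty$ and the bound is trivial. *)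

theory Defs
  imports "HOL-Probability.Probability"
begin

text \<open>Sample paths of the first-come-first-served single-server queue. The sequence \<open>t\<close> lists the
  interarrival times, so task \<open>n\<close> arrives at time \<open>t 0 + \<dots> + t n\<close>; \<open>v n\<close> is the service time of
  task \<open>n\<close>. The system is empty at time \<open>0\<close>.\<close>

definition arrival_time :: "(nat \<Rightarrow> real) \<Rightarrow> nat \<Rightarrow> real" where
  "arrival_time t n = (\<Sum>i\<le>n. t i)"

fun service_start :: "(nat \<Rightarrow> real) \<Rightarrow> (nat \<Rightarrow> real) \<Rightarrow> nat \<Rightarrow> real" where
  "service_start t v 0 = arrival_time t 0"
| "service_start t v (Suc n) = max (arrival_time t (Suc n)) (service_start t v n + v n)"

definition waiting_time :: "(nat \<Rightarrow> real) \<Rightarrow> (nat \<Rightarrow> real) \<Rightarrow> nat \<Rightarrow> real" where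
  "waiting_time t v n = service_start t v n - arrival_time t n"

definition sojourn_time :: "(nat \<Rightarrow> real) \<Rightarrow> (nat \<Rightarrow> real) \<Rightarrow> nat \<Rightarrow> real" where
  "sojourn_time t v n = waiting_time t v n + v n"

lemma waiting_time_lindley:
  "waiting_time t v 0 = 0"
  "waiting_time t v (Suc n) = max 0 (waiting_time t v n + v n - t (Suc n))"
  by (auto simp: waiting_time_def arrival_time_def max_def)

text \<open>Poisson arrivals of rate \<open>lam\<close> are given by their i.i.d. exponential interarrival times \<open>T n\<close>.
  \<open>S\<close> is a generic service time; the actual service times \<open>V n\<close> are distributed as \<open>S\<close>. The index
  type \<^typ>\<open>nat + nat\<close> expresses joint independence of all the \<open>T n\<close> and \<open>V n\<close>.\<close>

locale MG1_queue = prob_space M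
  for M :: "'a measure" and lam :: real
    and T V :: "nat \<Rightarrow> 'a \<Rightarrow> real" and S :: "'a \<Rightarrow> real" +
  assumes rate_pos: "0 < lam"
    and interarrival: "\<And>n. distributed M lborel (T n) (exponential_density lam)"
    and service_measurable: "S \<in> borel_measurable M"
    and service_nonneg: "AE \<omega> in M. 0 \<le> S \<omega>"
    and services_measurable: "\<And>n. V n \<in> borel_measurable M"
    and services_distr: "\<And>n. distr M borel (V n) = distr M borel S"
    and independent: "indep_vars (\<lambda>_. borel) (case_sum T V) (UNIV :: (nat + nat) set)"

text \<open>The steady-state sojourn time has the limiting law, as \<open>n\<close> tends to infinity, of the sojourn
  time of task \<open>n\<close>.\<close>

definition steady_state_sojourn_time ::
    "'a measure \<Rightarrow> (nat \<Rightarrow> 'a \<Rightarrow> real) \<Rightarrow> (nat \<Rightarrow> 'a \<Rightarrow> real) \<Rightarrow> ('a \<Rightarrow> real) \<Rightarrow> bool" where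
  "steady_state_sojourn_time M T V D \<longleftrightarrow>
     D \<in> borel_measurable M \<and>
     weak_conv_m
       (\<lambda>n. distr M borel (\<lambda>\<omega>. sojourn_time (\<lambda>i. T i \<omega>) (\<lambda>i. V i \<omega>) n))
       (distr M borel D)"

text \<open>For \<open>j \<ge> 3\<close>, \<open>dyadic_block j\<close> is the unique \<open>r \<ge> 3\<close> such that \<open>j = 2^(r-2) + i\<close> for some
  \<open>1 \<le> i \<le> 2^(r-2)\<close>. The coefficients \<open>b\<close> and exponents \<open>d\<close> are meaningful for \<open>k \<ge> 2\<close> and
  \<open>1 \<le> j \<le> 2^(k-1)\<close>; elsewhere their values are irrelevant. The recursions in the form they are
  usually written are \<open>bound_coeff_rec\<close> and \<open>bound_exponent_rec\<close> below.\<close>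

definition dyadic_block :: "nat \<Rightarrow> nat" where
  "dyadic_block j = (LEAST r. j \<le> 2 ^ (r - 1))"

fun bound_coeff :: "real \<Rightarrow> real \<Rightarrow> nat \<Rightarrow> nat \<Rightarrow> real" where
  "bound_coeff lam mu k j =
     (if k = 2 then (if j = 1 then lam / 6 else lam * mu / 24)
      else if j = 1 then lam * mu / fact (k + 2)
      else if j = 2 then lam / (6 * mu ^ (k - 2))
      else if 3 \<le> dyadic_block j \<and> dyadic_block j \<le> k
      then bound_coeff lam mu (dyadic_block j - 1) (j - 2 ^ (dyadic_block j - 2))
             / mu ^ (k - dyadic_block j + 1)
      else 0)"

fun bound_exponent :: "nat \<Rightarrow> nat \<Rightarrow> nat" where
  "bound_exponent k j =
     (if k = 2 then (if j = 1 then 3 else 4)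
      else if j = 1 then k + 2
      else if j = 2 then 3
      else if 3 \<le> dyadic_block j \<and> dyadic_block j \<le> k
      then bound_exponent (dyadic_block j - 1) (j - 2 ^ (dyadic_block j - 2))
      else 0)"

declare bound_coeff.simps [simp del] bound_exponent.simps [simp del]

lemma bound_coeff_base:
  "bound_coeff lam mu 2 1 = lam / 6"
  "bound_coeff lam mu 2 2 = lam * mu / 24"
  "3 \<le> k \<Longrightarrow> bound_coeff lam mu k 1 = lam * mu / fact (k + 2)"
  "3 \<le> k \<Longrightarrow> bound_coeff lam mu k 2 = lam / (6 * mu ^ (k - 2))"
  by (simp_all add: bound_coeff.simps)

lemma bound_exponent_base:
  "bound_exponent 2 1 = 3"
  "bound_exponent 2 2 = 4"
  "3 \<le> k \<Longrightarrow> bound_exponent k 1 = k + 2"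
  "3 \<le> k \<Longrightarrow> bound_exponent k 2 = 3"
  by (simp_all add: bound_exponent.simps)

lemma dyadic_block_eq:
  assumes "3 \<le> r" "1 \<le> i" "i \<le> 2 ^ (r - 2)"
  shows "dyadic_block (2 ^ (r - 2) + i) = r"
  unfolding dyadic_block_def
proof (rule Least_equality)
  have "r - 1 = Suc (r - 2)" using assms(1) by simp
  then show "2 ^ (r - 2) + i \<le> 2 ^ (r - 1)" using assms(3) by simp
next
  fix y assume y: "2 ^ (r - 2) + i \<le> 2 ^ (y - 1)"
  have "(2::nat) ^ (r - 2) < 2 ^ (y - 1)" using y assms(2) by linarith
  then have "r - 2 < y - 1" by (rule power_less_imp_less_exp[rotated]) simp
  then show "r \<le> y" using assms(1) by linarith
qed

lemma dyadic_index_ge_3: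
  assumes "3 \<le> r" "1 \<le> i"
  shows "3 \<le> 2 ^ (r - 2) + (i::nat)"
proof -
  have "(2::nat) ^ 1 \<le> 2 ^ (r - 2)" using assms(1) by (intro power_increasing) auto
  then show ?thesis using assms(2) by simp
qed

lemma bound_coeff_rec:
  assumes "3 \<le> r" "r \<le> k" "1 \<le> i" "i \<le> 2 ^ (r - 2)"
  shows "bound_coeff lam mu k (2 ^ (r - 2) + i) = bound_coeff lam mu (r - 1) i / mu ^ (k - r + 1)"
  using dyadic_index_ge_3[OF assms(1,3)] assms
  by (subst bound_coeff.simps) (simp add: dyadic_block_eq)

lemma bound_exponent_rec:
  assumes "3 \<le> r" "r \<le> k" "1 \<le> i" "i \<le> 2 ^ (r - 2)"
  shows "bound_exponent k (2 ^ (r - 2) + i) = bound_exponent (r - 1) i"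
  using dyadic_index_ge_3[OF assms(1,3)] assms
  by (subst bound_exponent.simps) (simp add: dyadic_block_eq)

text \<open>The constant \<open>C\<^sub>2\<close>, extended-real valued because the integrals against the law of \<open>S\<close> may be
  infinite.\<close>

definition C2_bound ::
    "'a measure \<Rightarrow> ('a \<Rightarrow> real) \<Rightarrow> real \<Rightarrow> real \<Rightarrow> nat \<Rightarrow> real \<Rightarrow> ennreal" where
  "C2_bound M S lam mu k C1 =
     ennreal (1 / (mu * fact k) * C1)
     + 2 * (\<Sum>j = 1..2 ^ (k - 1). ennreal (bound_coeff lam mu k j) *
              (\<integral>\<^sup>+s\<in>{0..}. ennreal (s ^ bound_exponent k j) \<partial>(distr M borel S)))"

end

theory Submission
  imports Defs "HOL-Real_Asymp.Real_Asymp"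
begin

text \<open>The difference on the left-hand side is in fact \<open>0\<close>. By the Lindley recursion and weak
  convergence, the steady-state law is invariant, so \<open>D = W + S\<close> in law with
  \<open>W = max 0 (D' - X)\<close> for \<open>D'\<close> distributed as \<open>D\<close> and an independent \<open>X\<close>, exponential of rate
  \<open>\<lambda>\<close>. Integrating out \<open>X\<close> gives \<open>E (h W) + E (h' W) / \<lambda> = E (h (W + S))\<close> whenever
  \<open>h 0 = h' 0 = 0\<close>. Taking for \<open>h\<close> a bounded approximation of \<open>w ^ (j + 1)\<close> yields the Takacs
  recursion, which expresses the moments of \<open>W\<close> up to order \<open>k\<close> by those of \<open>S\<close> up to order
  \<open>k + 1\<close>. Since the latter agree with those of \<open>Exp \<mu>\<close>, the moment \<open>E (D ^ k)\<close> is the one of the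
  M/M/1 queue, whose sojourn time is \<open>Exp (\<mu> - \<lambda>)\<close>.\<close>

section \<open>Invariance of the weak limit of a chain driven by i.i.d. innovations\<close>

text \<open>One step of the chain turns a characteristic function into the integral of a bounded
  continuous function of the current state (the Feller property). Weak convergence therefore passes
  through \<open>step\<close>, and the limits of the two sides have equal characteristic
  functions.\<close>

lemma weak_limit_of_chain_stationary:
  fixes \<mu> :: "nat \<Rightarrow> real measure" and Q :: "real measure" and L :: "'b measure"
    and \<phi> :: "real \<times> 'b \<Rightarrow> real"
  assumes \<mu>: "\<And>n. real_distribution (\<mu> n)" and Q: "real_distribution Q" and L: "prob_space L"
    and lim: "weak_conv_m \<mu> Q"
    and meas [measurable]: "\<phi> \<in> borel_measurable (borel \<Otimes>\<^sub>M L)"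
    and cont: "\<And>x y. isCont (\<lambda>x. \<phi> (x, y)) x"
    and step: "\<And>n. \<mu> (Suc n) = distr (\<mu> n \<Otimes>\<^sub>M L) borel \<phi>"
  shows "Q = distr (Q \<Otimes>\<^sub>M L) borel \<phi>"
proof -
  interpret L: prob_space L by fact
  have image: "real_distribution (distr (P \<Otimes>\<^sub>M L) borel \<phi>) \<and>
      char (distr (P \<Otimes>\<^sub>M L) borel \<phi>) t = (\<integral>x. (\<integral>y. iexp (t * \<phi> (x, y)) \<partial>L) \<partial>P)"
    if "real_distribution P" for P t
  proof -
    interpret P: real_distribution P by fact
    interpret PL: pair_prob_space P L ..
    have m: "\<phi> \<in> borel_measurable (P \<Otimes>\<^sub>M L)"
      by (subst measurable_cong_sets[OF sets_pair_measure_cong[OF P.events_eq_borel refl] refl]) (rule meas)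
    have "integrable (P \<Otimes>\<^sub>M L) (\<lambda>z. iexp (t * \<phi> z))"
      using m by (intro PL.integrable_const_bound[where B = 1]) auto
    from PL.integral_fst'[OF this] m show ?thesis
      by (auto simp: char_def integral_distr intro!: PL.real_distribution_distr)
  qed
  show ?thesis
  proof (rule Levy_uniqueness[OF Q conjunct1[OF image[OF Q]]], rule ext)
    fix t
    \<comment> \<open>\<open>?G x\<close> is the conditional characteristic function of the next
      state given the current state \<open>x\<close>.\<close>
    let ?G = "\<lambda>x. \<integral>y. iexp (t * \<phi> (x, y)) \<partial>L"
    have mx [measurable]: "(\<lambda>y. \<phi> (x, y)) \<in> borel_measurable L" for x
      by measurable
    have "isCont ?G x" for x
      unfolding continuous_at_sequentially comp_def
    proof (intro allI impI)
      fix X :: "nat \<Rightarrow> real" assume X: "X \<longlonglongrightarrow> x"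
      show "(\<lambda>n. ?G (X n)) \<longlonglongrightarrow> ?G x"
      proof (rule integral_dominated_convergence[where w = "\<lambda>_. 1"])
        have "(\<lambda>n. iexp (t * \<phi> (X n, y))) \<longlonglongrightarrow> iexp (t * \<phi> (x, y))" for y
          by (intro tendsto_intros isCont_tendsto_compose[OF cont X])
        then show "AE y in L. (\<lambda>n. iexp (t * \<phi> (X n, y))) \<longlonglongrightarrow> iexp (t * \<phi> (x, y))"
          by simp
      qed auto
    qed
    moreover have "norm (?G x) \<le> 1" for x
    proof -
      have "norm (?G x) \<le> (\<integral>y. norm (iexp (t * \<phi> (x, y))) \<partial>L)"
        by (rule integral_norm_bound)
      then show ?thesis by (simp add: L.prob_space)
    qed
    ultimately have "(\<lambda>n. integral\<^sup>L (\<mu> n) ?G) \<longlonglongrightarrow> integral\<^sup>L Q ?G"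
      by (rule weak_conv_imp_integral_bdd_continuous_conv[OF \<mu> Q lim])
    then have "(\<lambda>n. char (\<mu> (Suc n)) t) \<longlonglongrightarrow> char (distr (Q \<Otimes>\<^sub>M L) borel \<phi>) t"
      using image[OF \<mu>] image[OF Q] by (simp add: step)
    moreover have "(\<lambda>n. char (\<mu> (Suc n)) t) \<longlonglongrightarrow> char Q t"
      using levy_continuity1[OF \<mu> Q lim] by (rule LIMSEQ_Suc)
    ultimately show "char Q t = char (distr (Q \<Otimes>\<^sub>M L) borel \<phi>) t"
      by (rule LIMSEQ_unique[rotated])
  qed
qed

section \<open>Product laws\<close>

text \<open>Pushing the product law of \<open>X\<close> and \<open>Y\<close> forward along
  \<open>f\<close> and \<open>g\<close> keeps it a product. In \<open>distr_sojourn_Suc\<close>,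
  \<open>X\<close> and \<open>Y\<close> are the restrictions of the input family to past and to next
  indices.\<close>

lemma (in prob_space) distr_indep_pair:
  assumes indep: "indep_var MA X MB Y"
    and f [measurable]: "f \<in> measurable MA A" and g [measurable]: "g \<in> measurable MB B"
  shows "distr M A (\<lambda>\<omega>. f (X \<omega>)) \<Otimes>\<^sub>M distr M B (\<lambda>\<omega>. g (Y \<omega>)) =
    distr M (A \<Otimes>\<^sub>M B) (\<lambda>\<omega>. (f (X \<omega>), g (Y \<omega>)))"
proof -
  have [measurable]: "X \<in> measurable M MA" "Y \<in> measurable M MB"
    and eq: "distr M MA X \<Otimes>\<^sub>M distr M MB Y = distr M (MA \<Otimes>\<^sub>M MB) (\<lambda>\<omega>. (X \<omega>, Y \<omega>))"
    using indep unfolding indep_var_distribution_eq by auto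
  interpret g: prob_space "distr M B (\<lambda>\<omega>. g (Y \<omega>))"
    by (rule prob_space_distr) measurable
  have comp: "distr M A (\<lambda>\<omega>. f (X \<omega>)) = distr (distr M MA X) A f"
    "distr M B (\<lambda>\<omega>. g (Y \<omega>)) = distr (distr M MB Y) B g"
    by (simp_all add: distr_distr comp_def)
  show ?thesis
    unfolding comp
    by (subst pair_measure_distr)
      (simp_all add: comp(2)[symmetric] g.sigma_finite_measure_axioms eq distr_distr comp_def)
qed

lemma (in pair_sigma_finite) integrable_mult_pair:
  fixes f :: "'a \<Rightarrow> real" and g :: "'b \<Rightarrow> real"
  assumes f: "integrable M1 f" and g: "integrable M2 g"
  shows "integrable (M1 \<Otimes>\<^sub>M M2) (\<lambda>z. f (fst z) * g (snd z))"
    and "(\<integral>z. f (fst z) * g (snd z) \<partial>(M1 \<Otimes>\<^sub>M M2)) = (\<integral>x. f x \<partial>M1) * (\<integral>y. g y \<partial>M2)"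
proof -
  have [measurable]: "f \<in> borel_measurable M1" "g \<in> borel_measurable M2"
    using f g by auto
  show *: "integrable (M1 \<Otimes>\<^sub>M M2) (\<lambda>z. f (fst z) * g (snd z))"
    using f g by (intro Fubini_integrable) (auto simp: abs_mult)
  show "(\<integral>z. f (fst z) * g (snd z) \<partial>(M1 \<Otimes>\<^sub>M M2)) = (\<integral>x. f x \<partial>M1) * (\<integral>y. g y \<partial>M2)"
    by (subst integral_fst'[OF *, symmetric]) simp
qed

section \<open>Bounded substitutes for powers\<close>

text \<open>\<open>damp \<theta> w\<close> is a bounded substitute for \<open>w\<close>. It is chosen for its addition formula \<open>damp_add\<close>,
  which lets the binomial theorem separate \<open>W\<close> from \<open>S\<close> in \<open>(damp \<theta> (W + S)) ^ j\<close>.\<close>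

definition damp :: "real \<Rightarrow> real \<Rightarrow> real" where
  "damp \<theta> w = (1 - exp (- \<theta> * w)) / \<theta>"

lemma damp_measurable [measurable]: "damp \<theta> \<in> borel_measurable borel"
  unfolding damp_def by measurable

lemma damp_add: "damp \<theta> (w + s) = exp (- \<theta> * w) * damp \<theta> s + damp \<theta> w"
  \<comment> \<open>For \<open>\<theta> = 0\<close>, division by zero makes \<open>damp\<close>
    vanish identically, so both sides are 0.\<close>
  by (cases "\<theta> = 0") (auto simp: damp_def field_simps simp flip: exp_add)

lemma damp_bounds:
  assumes "0 < \<theta>" "0 \<le> w"
  shows "0 \<le> damp \<theta> w" "damp \<theta> w \<le> w" "damp \<theta> w \<le> 1 / \<theta>"
  using assms exp_ge_add_one_self[of "- \<theta> * w"]
  by (auto simp: damp_def field_simps)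

lemma damp_has_real_derivative:
  "\<theta> \<noteq> 0 \<Longrightarrow> (damp \<theta> has_real_derivative exp (- \<theta> * w)) (at w)"
  unfolding damp_def by (auto intro!: derivative_eq_intros)

lemma damp_tendsto: "(\<lambda>n. damp (1 / Suc n) w) \<longlonglongrightarrow> w"
proof (cases "w = 0")
  case False
  then consider "w > 0" | "w < 0" by linarith
  then show ?thesis unfolding damp_def by cases real_asymp+
qed (simp add: damp_def)

text \<open>The exponential factors are those that \<open>damp_add\<close> produces. The bound by
  \<open>w ^ j\<close> serves as a majorant when \<open>\<theta>\<close> tends to 0; the constant
  bound gives integrability under any probability law on the half-line.\<close>

lemma damp_power_bounds:
  assumes "0 < \<theta>" "0 \<le> w"
  shows "0 \<le> damp \<theta> w ^ j * exp (- \<theta> * w) ^ i" "damp \<theta> w ^ j * exp (- \<theta> * w) ^ i \<le> w ^ j"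
    "damp \<theta> w ^ j * exp (- \<theta> * w) ^ i \<le> (1 / \<theta>) ^ j"
proof -
  note b = damp_bounds[OF assms]
  have e: "0 \<le> exp (- \<theta> * w) ^ i" "exp (- \<theta> * w) ^ i \<le> 1"
    using assms by (auto intro!: power_le_one)
  show "0 \<le> damp \<theta> w ^ j * exp (- \<theta> * w) ^ i" using b e by simp
  show "damp \<theta> w ^ j * exp (- \<theta> * w) ^ i \<le> w ^ j"
    using mult_mono[OF power_mono[OF b(2,1), of j] e(2)] e b assms by simp
  show "damp \<theta> w ^ j * exp (- \<theta> * w) ^ i \<le> (1 / \<theta>) ^ j"
    using mult_mono[OF power_mono[OF b(3,1), of j] e(2)] e b assms by simp
qed

text \<open>Fatou's lemma along \<open>\<theta> = 1 / (n + 1)\<close>: the damped integrands tend to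
  \<open>w ^ j\<close>, and their integrals are bounded by \<open>C\<close> uniformly in
  \<open>\<theta>\<close>.\<close>

lemma integrable_power_of_damped_bound:
  fixes N :: "real measure"
  assumes sets: "sets N = sets borel" and nonneg: "AE w in N. 0 \<le> w"
    and int: "\<And>\<theta>. 0 < \<theta> \<Longrightarrow> integrable N (\<lambda>w. damp \<theta> w ^ j * exp (- \<theta> * w))"
    and bound: "\<And>\<theta>. 0 < \<theta> \<Longrightarrow> (\<integral>w. damp \<theta> w ^ j * exp (- \<theta> * w) \<partial>N) \<le> C"
  shows "integrable N (\<lambda>w. w ^ j)"
proof (rule integrableI_bounded)
  note [measurable_cong] = sets
  show "(\<lambda>w. w ^ j) \<in> borel_measurable N" by measurable
  let ?\<theta> = "\<lambda>n. 1 / real (Suc n)"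
  let ?u = "\<lambda>n w. ennreal (damp (?\<theta> n) w ^ j * exp (- ?\<theta> n * w))"
  have lim: "liminf (\<lambda>n. ?u n w) = ennreal (w ^ j)" for w
  proof (rule lim_imp_Liminf)
    have "(\<lambda>n. - ?\<theta> n * w) \<longlonglongrightarrow> 0" by real_asymp
    then have "(\<lambda>n. damp (?\<theta> n) w ^ j * exp (- ?\<theta> n * w)) \<longlonglongrightarrow> w ^ j * exp 0"
      by (intro tendsto_intros damp_tendsto)
    then show "(\<lambda>n. ?u n w) \<longlonglongrightarrow> ennreal (w ^ j)"
      by (intro tendsto_ennrealI) simp
  qed simp
  have "(\<integral>\<^sup>+ w. ennreal (norm (w ^ j)) \<partial>N) = (\<integral>\<^sup>+ w. liminf (\<lambda>n. ?u n w) \<partial>N)"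
    unfolding lim using nonneg by (intro nn_integral_cong_AE) auto
  also have "\<dots> \<le> liminf (\<lambda>n. \<integral>\<^sup>+ w. ?u n w \<partial>N)"
    by (rule nn_integral_liminf) measurable
  also have "\<dots> \<le> liminf (\<lambda>n. ennreal C)"
  proof (intro Liminf_mono always_eventually allI)
    fix n
    have "AE w in N. 0 \<le> damp (?\<theta> n) w ^ j * exp (- ?\<theta> n * w)"
      using nonneg damp_power_bounds(1)[of "?\<theta> n" _ j 1] by (auto elim!: eventually_mono)
    then show "(\<integral>\<^sup>+ w. ?u n w \<partial>N) \<le> ennreal C"
      using int[of "?\<theta> n"] bound[of "?\<theta> n"]
      by (subst nn_integral_eq_integral) (auto intro: ennreal_leI)
  qed
  also have "\<dots> = ennreal C" by (simp add: Liminf_const)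
  finally show "(\<integral>\<^sup>+ w. ennreal (norm (w ^ j)) \<partial>N) < \<infinity>"
    by (simp add: le_less_trans)
qed

section \<open>Takacs moment recursion for the stationary waiting time\<close>

text \<open>\<open>N\<close> is the law of W and \<open>B\<close> that of S. In
  \<open>balance\<close> the bounds are imposed on the nonnegative half-line only: both laws live
  there, and powers of \<open>damp \<theta>\<close> are unbounded on the negative axis.\<close>

locale stationary_waiting_law = pair_prob_space N B
  for N B :: "real measure" +
  fixes lam :: real
  assumes rate: "0 < lam"
    and sets_N [measurable_cong]: "sets N = sets borel"
    and sets_B [measurable_cong]: "sets B = sets borel"
    and N_nonneg: "AE w in N. 0 \<le> w"
    and B_nonneg: "AE s in B. 0 \<le> s"
    and balance: "\<And>h f C. (\<And>x. (h has_real_derivative f x) (at x)) \<Longrightarrow> (\<And>x. isCont f x) \<Longrightarrow>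
      h 0 = 0 \<Longrightarrow> f 0 = 0 \<Longrightarrow> (\<And>x. 0 \<le> x \<Longrightarrow> \<bar>h x\<bar> \<le> C) \<Longrightarrow> (\<And>x. 0 \<le> x \<Longrightarrow> \<bar>f x\<bar> \<le> C) \<Longrightarrow>
      (\<integral>w. h w + f w / lam \<partial>N) = (\<integral>z. h (fst z + snd z) \<partial>(N \<Otimes>\<^sub>M B))"
begin

lemma integrable_damp_N: "0 < \<theta> \<Longrightarrow> integrable N (\<lambda>w. damp \<theta> w ^ j * exp (- \<theta> * w) ^ i)"
  using N_nonneg damp_power_bounds(1,3)
  by (intro M1.integrable_const_bound[where B = "(1 / \<theta>) ^ j"]) (auto elim!: eventually_mono)

lemma integrable_damp_B: "0 < \<theta> \<Longrightarrow> integrable B (\<lambda>s. damp \<theta> s ^ i)"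
  using B_nonneg damp_power_bounds(1,3)[of \<theta> _ i 0]
  by (intro M2.integrable_const_bound[where B = "(1 / \<theta>) ^ i"]) (auto elim!: eventually_mono)

text \<open>This is \<open>balance\<close> for \<open>h = damp \<theta> ^ (j + 1)\<close>, with the
  right-hand side expanded by \<open>damp_add\<close> and the binomial theorem. The condition
  \<open>1 \<le> j\<close> makes the derivative of \<open>h\<close> vanish at 0.\<close>

lemma damped_moment_identity:
  assumes \<theta>: "0 < \<theta>" and j: "1 \<le> j"
  shows "real (Suc j) / lam * (\<integral>w. damp \<theta> w ^ j * exp (- \<theta> * w) \<partial>N) =
    (\<Sum>i = 1..Suc j. real (Suc j choose i) *
       ((\<integral>w. damp \<theta> w ^ (Suc j - i) * exp (- \<theta> * w) ^ i \<partial>N) * (\<integral>s. damp \<theta> s ^ i \<partial>B)))"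
    (is "?l = (\<Sum>i = 1..Suc j. ?t i)")
proof -
  let ?h = "\<lambda>w. damp \<theta> w ^ Suc j" and ?f = "\<lambda>w. real (Suc j) * (damp \<theta> w ^ j * exp (- \<theta> * w))"
  have h_int: "integrable N ?h" using integrable_damp_N[OF \<theta>, of "Suc j" 0] by simp
  have f_int: "integrable N ?f" using integrable_damp_N[OF \<theta>, of j 1] by simp
  have "integral\<^sup>L N ?h + ?l = (\<integral>w. ?h w + ?f w / lam \<partial>N)"
    using h_int f_int by (subst Bochner_Integration.integral_add) auto
  also have "\<dots> = (\<integral>z. ?h (fst z + snd z) \<partial>(N \<Otimes>\<^sub>M B))"
  \<comment> \<open>One constant has to bound both \<open>?h\<close> and \<open>?f\<close>, hence
    the sum of their separate bounds.\<close>
  proof (rule balance[where C = "(1 / \<theta>) ^ Suc j + real (Suc j) * (1 / \<theta>) ^ j"])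
    show "(?h has_real_derivative ?f x) (at x)" for x
      using DERIV_power_Suc[OF damp_has_real_derivative, of \<theta> j x] \<theta> by (simp add: mult_ac)
    show "isCont ?f x" for x
      unfolding damp_def using \<theta> by (intro continuous_intros) auto
    show "?h 0 = 0" "?f 0 = 0" using j by (auto simp: damp_def)
    fix x :: real assume x: "0 \<le> x"
    have "0 \<le> ?h x" "?h x \<le> (1 / \<theta>) ^ Suc j" "0 \<le> ?f x" "?f x \<le> real (Suc j) * (1 / \<theta>) ^ j"
      using damp_power_bounds(1,3)[OF \<theta> x, of "Suc j" 0] damp_power_bounds(1,3)[OF \<theta> x, of j 1]
      by (auto intro!: mult_left_mono simp del: power_Suc)
    moreover have "0 \<le> (1 / \<theta>) ^ Suc j" "0 \<le> real (Suc j) * (1 / \<theta>) ^ j" using \<theta> by auto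
    ultimately show "\<bar>?h x\<bar> \<le> (1 / \<theta>) ^ Suc j + real (Suc j) * (1 / \<theta>) ^ j"
      "\<bar>?f x\<bar> \<le> (1 / \<theta>) ^ Suc j + real (Suc j) * (1 / \<theta>) ^ j" by linarith+
  qed
  also have "\<dots> = (\<integral>z. (\<Sum>i\<le>Suc j. real (Suc j choose i) *
      ((damp \<theta> (fst z) ^ (Suc j - i) * exp (- \<theta> * fst z) ^ i) * damp \<theta> (snd z) ^ i)) \<partial>(N \<Otimes>\<^sub>M B))"
    unfolding damp_add binomial_ring
    by (intro Bochner_Integration.integral_cong refl sum.cong) (simp_all add: power_mult_distrib mult_ac)
  also have "\<dots> = (\<Sum>i\<le>Suc j. ?t i)"
  proof (subst Bochner_Integration.integral_sum)
    fix i
    show "integrable (N \<Otimes>\<^sub>M B) (\<lambda>z. real (Suc j choose i) *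
      ((damp \<theta> (fst z) ^ (Suc j - i) * exp (- \<theta> * fst z) ^ i) * damp \<theta> (snd z) ^ i))"
      by (intro integrable_mult_right integrable_mult_pair(1)[OF integrable_damp_N integrable_damp_B] \<theta>)
  next
    show "(\<Sum>i\<le>Suc j. \<integral>z. real (Suc j choose i) *
      ((damp \<theta> (fst z) ^ (Suc j - i) * exp (- \<theta> * fst z) ^ i) * damp \<theta> (snd z) ^ i) \<partial>(N \<Otimes>\<^sub>M B)) =
      (\<Sum>i\<le>Suc j. ?t i)"
      by (intro sum.cong refl)
        (simp only: integral_mult_right_zero integrable_mult_pair(2)[OF integrable_damp_N[OF \<theta>] integrable_damp_B[OF \<theta>]])
  qed
  \<comment> \<open>The term for \<open>i = 0\<close> is the integral of \<open>?h\<close> against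
    \<open>N\<close> and cancels with the one on the left.\<close>
  also have "\<dots> = ?t 0 + (\<Sum>i = 1..Suc j. ?t i)"
    by (simp add: sum.atLeast_Suc_atMost atMost_atLeast0 del: sum.cl_ivl_Suc)
  also have "?t 0 = integral\<^sup>L N ?h"
    by (simp add: M2.prob_space)
  finally show ?thesis by linarith
qed

lemma damped_le_moment_N:
  assumes "0 < \<theta>" "integrable N (\<lambda>w. w ^ j)"
  shows "(\<integral>w. damp \<theta> w ^ j * exp (- \<theta> * w) ^ i \<partial>N) \<le> (\<integral>w. w ^ j \<partial>N)"
  using N_nonneg damp_power_bounds(2)[OF assms(1)]
  by (intro integral_mono_AE integrable_damp_N assms) (auto elim!: eventually_mono)

lemma damped_le_moment_B:
  assumes "0 < \<theta>" "integrable B (\<lambda>s. s ^ i)"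
  shows "(\<integral>s. damp \<theta> s ^ i \<partial>B) \<le> (\<integral>s. s ^ i \<partial>B)"
  using B_nonneg damp_power_bounds(2)[OF assms(1), of _ i 0]
  by (intro integral_mono_AE integrable_damp_B assms) (auto elim!: eventually_mono)

lemma damped_nonneg:
  assumes "0 < \<theta>"
  shows "0 \<le> (\<integral>w. damp \<theta> w ^ j * exp (- \<theta> * w) ^ i \<partial>N)" "0 \<le> (\<integral>s. damp \<theta> s ^ i \<partial>B)"
  using N_nonneg B_nonneg damp_power_bounds(1)[OF assms] damp_power_bounds(1)[OF assms, of _ i 0]
  by (auto intro!: integral_nonneg_AE elim!: eventually_mono)

text \<open>Strong induction on \<open>j\<close>. In the damped identity only the term
  \<open>i = 1\<close> contains the damped moment of order \<open>j\<close>; its coefficient is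
  controlled by the load, so a load below 1 allows absorbing it on the left. What remains is bounded
  independently of \<open>\<theta>\<close>.\<close>

lemma integrable_waiting_moment:
  assumes S_int: "\<And>i. i \<le> Suc k \<Longrightarrow> integrable B (\<lambda>s. s ^ i)"
    and load: "lam * (\<integral>s. s \<partial>B) < 1" and "j \<le> k"
  shows "integrable N (\<lambda>w. w ^ j)"
  using \<open>j \<le> k\<close>
proof (induction j rule: less_induct)
  case (less j)
  show ?case
  proof (cases "j = 0")
    case False
    \<comment> \<open>The terms \<open>i \<ge> 2\<close> with the damping removed: they involve
      moments of W of order at most \<open>j - 1\<close>, finite by induction, and moments of S of
      order at most \<open>k + 1\<close>.\<close>
    define C where "C = (\<Sum>i = 2..Suc j. real (Suc j choose i) *
      ((\<integral>w. w ^ (Suc j - i) \<partial>N) * (\<integral>s. s ^ i \<partial>B)))"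
    define r where "r = 1 - lam * (\<integral>s. s \<partial>B)"
    have r: "0 < r" using load by (simp add: r_def)
    show ?thesis
    proof (rule integrable_power_of_damped_bound[OF sets_N N_nonneg])
      fix \<theta> :: real assume \<theta>: "0 < \<theta>"
      define A where "A = (\<integral>w. damp \<theta> w ^ j * exp (- \<theta> * w) \<partial>N)"
      have A0: "0 \<le> A" using damped_nonneg(1)[OF \<theta>, of j 1] by (simp add: A_def)
      show "integrable N (\<lambda>w. damp \<theta> w ^ j * exp (- \<theta> * w))"
        using integrable_damp_N[OF \<theta>, of j 1] by simp
      have split: "(\<Sum>i = 1..Suc j. t i) = t 1 + (\<Sum>i = 2..Suc j. t i)" for t :: "nat \<Rightarrow> real"
        by (subst sum.atLeast_Suc_atMost) (auto simp: numeral_2_eq_2)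
      have "real (Suc j) / lam * A = real (Suc j) * (A * (\<integral>s. damp \<theta> s \<partial>B)) +
        (\<Sum>i = 2..Suc j. real (Suc j choose i) *
         ((\<integral>w. damp \<theta> w ^ (Suc j - i) * exp (- \<theta> * w) ^ i \<partial>N) * (\<integral>s. damp \<theta> s ^ i \<partial>B)))"
        using False unfolding A_def
        by (subst damped_moment_identity[OF \<theta>, of j]) (simp_all only: split, simp_all)
      also have "\<dots> \<le> real (Suc j) * (A * (\<integral>s. s \<partial>B)) + C"
        unfolding C_def
      proof (intro add_mono sum_mono mult_left_mono mult_mono)
        show "(\<integral>s. damp \<theta> s \<partial>B) \<le> (\<integral>s. s \<partial>B)"
          using damped_le_moment_B[OF \<theta> S_int[of 1]] by simp
        fix i assume i: "i \<in> {2..Suc j}"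
        show "(\<integral>w. damp \<theta> w ^ (Suc j - i) * exp (- \<theta> * w) ^ i \<partial>N) \<le> (\<integral>w. w ^ (Suc j - i) \<partial>N)"
          using i less.prems by (intro damped_le_moment_N \<theta> less.IH) auto
        show "(\<integral>s. damp \<theta> s ^ i \<partial>B) \<le> (\<integral>s. s ^ i \<partial>B)"
          using i less.prems by (intro damped_le_moment_B \<theta> S_int) auto
        show "0 \<le> (\<integral>w. w ^ (Suc j - i) \<partial>N)"
          using N_nonneg by (auto intro!: integral_nonneg_AE elim!: eventually_mono)
      qed (use A0 damped_nonneg[OF \<theta>] in auto)
      finally have "real (Suc j) * (A * r) \<le> lam * C"
        using rate by (simp add: r_def field_simps)
      then have "A * r \<le> lam * C / real (Suc j)" by (simp add: field_simps)
      then show "A \<le> lam * C / real (Suc j) / r" unfolding pos_le_divide_eq[OF r] .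
    qed
  qed simp
qed

text \<open>Let \<open>\<theta>\<close> tend to 0 in \<open>damped_moment_identity\<close>.
  Dominated convergence applies because the undamped powers are integrable majorants.\<close>

theorem waiting_moment_recursion:
  assumes S_int: "\<And>i. i \<le> Suc k \<Longrightarrow> integrable B (\<lambda>s. s ^ i)"
    and load: "lam * (\<integral>s. s \<partial>B) < 1" and j: "1 \<le> j" "j \<le> k"
  shows "real (Suc j) / lam * (\<integral>w. w ^ j \<partial>N) =
    (\<Sum>i = 1..Suc j. real (Suc j choose i) * ((\<integral>w. w ^ (Suc j - i) \<partial>N) * (\<integral>s. s ^ i \<partial>B)))"
proof -
  let ?\<theta> = "\<lambda>n. 1 / real (Suc n)"
  have \<theta>: "0 < ?\<theta> n" for n by simp
  have N: "(\<lambda>n. \<integral>w. damp (?\<theta> n) w ^ a * exp (- ?\<theta> n * w) ^ i \<partial>N) \<longlonglongrightarrow> (\<integral>w. w ^ a \<partial>N)"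
    if "a \<le> k" for a i
  proof (rule integral_dominated_convergence)
    show "integrable N (\<lambda>w. w ^ a)" by (rule integrable_waiting_moment[OF S_int load that])
    have "(\<lambda>n. damp (?\<theta> n) w ^ a * exp (- ?\<theta> n * w) ^ i) \<longlonglongrightarrow> w ^ a" for w
    proof -
      have "(\<lambda>n. - ?\<theta> n * w) \<longlonglongrightarrow> 0" by real_asymp
      then have "(\<lambda>n. damp (?\<theta> n) w ^ a * exp (- ?\<theta> n * w) ^ i) \<longlonglongrightarrow> w ^ a * exp 0 ^ i"
        by (intro tendsto_intros damp_tendsto)
      then show ?thesis by simp
    qed
    then show "AE w in N. (\<lambda>n. damp (?\<theta> n) w ^ a * exp (- ?\<theta> n * w) ^ i) \<longlonglongrightarrow> w ^ a"
      by simp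
    show "AE w in N. norm (damp (?\<theta> n) w ^ a * exp (- ?\<theta> n * w) ^ i) \<le> w ^ a" for n
      using N_nonneg by eventually_elim (use damp_power_bounds(1,2)[OF \<theta>] in simp)
  qed measurable
  have B: "(\<lambda>n. \<integral>s. damp (?\<theta> n) s ^ i \<partial>B) \<longlonglongrightarrow> (\<integral>s. s ^ i \<partial>B)" if "i \<le> Suc k" for i
  proof (rule integral_dominated_convergence)
    show "integrable B (\<lambda>s. s ^ i)" by (rule S_int[OF that])
    show "AE s in B. (\<lambda>n. damp (?\<theta> n) s ^ i) \<longlonglongrightarrow> s ^ i"
      by (intro always_eventually allI tendsto_intros damp_tendsto)
    show "AE s in B. norm (damp (?\<theta> n) s ^ i) \<le> s ^ i" for n
      using B_nonneg
    proof eventually_elim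
      case (elim s)
      show ?case using damp_power_bounds(1,2)[OF \<theta> elim, of n i 0] by simp
    qed
  qed measurable
  have "(\<lambda>n. real (Suc j) / lam * (\<integral>w. damp (?\<theta> n) w ^ j * exp (- ?\<theta> n * w) \<partial>N))
      \<longlonglongrightarrow> real (Suc j) / lam * (\<integral>w. w ^ j \<partial>N)"
    using N[OF j(2), of 1] by (intro tendsto_intros) simp
  moreover have "(\<lambda>n. real (Suc j) / lam * (\<integral>w. damp (?\<theta> n) w ^ j * exp (- ?\<theta> n * w) \<partial>N))
      \<longlonglongrightarrow> (\<Sum>i = 1..Suc j. real (Suc j choose i) * ((\<integral>w. w ^ (Suc j - i) \<partial>N) * (\<integral>s. s ^ i \<partial>B)))"
    unfolding damped_moment_identity[OF \<theta> j(1)]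
    using j by (intro tendsto_intros N B) auto
  ultimately show ?thesis by (rule LIMSEQ_unique)
qed

text \<open>Moments of S up to order \<open>k + 1\<close> are assumed because the moment of W of
  order \<open>k\<close> depends on them.\<close>

lemma sojourn_moment:
  assumes S_int: "\<And>i. i \<le> Suc k \<Longrightarrow> integrable B (\<lambda>s. s ^ i)"
    and load: "lam * (\<integral>s. s \<partial>B) < 1"
  shows "integrable (N \<Otimes>\<^sub>M B) (\<lambda>z. (fst z + snd z) ^ k)"
    and "(\<integral>z. (fst z + snd z) ^ k \<partial>(N \<Otimes>\<^sub>M B)) =
      (\<Sum>i\<le>k. real (k choose i) * ((\<integral>w. w ^ (k - i) \<partial>N) * (\<integral>s. s ^ i \<partial>B)))"
proof -
  have eq: "(fst z + snd z) ^ k = (\<Sum>i\<le>k. real (k choose i) * (fst z ^ (k - i) * snd z ^ i))"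
    for z :: "real \<times> real"
    \<comment> \<open>The summands are swapped so that \<open>i\<close> becomes the exponent of the
      service time, as in the recursion.\<close>
    unfolding add.commute[of "fst z"] binomial_ring by (simp add: mult_ac)
  have N: "integrable N (\<lambda>w. w ^ (k - i))" and B: "i \<le> k \<Longrightarrow> integrable B (\<lambda>s. s ^ i)" for i
    using integrable_waiting_moment[OF S_int load, of k "k - i"] S_int by auto
  show "integrable (N \<Otimes>\<^sub>M B) (\<lambda>z. (fst z + snd z) ^ k)"
    unfolding eq
    by (intro Bochner_Integration.integrable_sum integrable_mult_right integrable_mult_pair(1) N B) simp
  show "(\<integral>z. (fst z + snd z) ^ k \<partial>(N \<Otimes>\<^sub>M B)) =
      (\<Sum>i\<le>k. real (k choose i) * ((\<integral>w. w ^ (k - i) \<partial>N) * (\<integral>s. s ^ i \<partial>B)))"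
    unfolding eq
  proof (subst Bochner_Integration.integral_sum)
    show "integrable (N \<Otimes>\<^sub>M B) (\<lambda>z. real (k choose i) * (fst z ^ (k - i) * snd z ^ i))"
      if "i \<in> {..k}" for i
      using that by (intro integrable_mult_right integrable_mult_pair(1) N B) simp
    show "(\<Sum>i\<le>k. \<integral>z. real (k choose i) * (fst z ^ (k - i) * snd z ^ i) \<partial>(N \<Otimes>\<^sub>M B)) =
      (\<Sum>i\<le>k. real (k choose i) * ((\<integral>w. w ^ (k - i) \<partial>N) * (\<integral>s. s ^ i \<partial>B)))"
      by (intro sum.cong refl) (simp add: integrable_mult_pair(2)[OF N B])
  qed
qed

end

section \<open>Solution of the recursion for exponential service moments\<close>

text \<open>After division by factorials the recursion says \<open>\<alpha> j = (lam / mu) * \<gamma> j\<close>, where \<open>\<gamma>\<close> is the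
  convolution of \<open>\<alpha>\<close> with the powers of \<open>1 / mu\<close>.\<close>

lemma exponential_service_recursion_solution:
  fixes a :: "nat \<Rightarrow> real"
  assumes rates: "0 < lam" "lam < mu" and a0: "a 0 = 1"
    and rec: "\<And>j. 1 \<le> j \<Longrightarrow> j \<le> k \<Longrightarrow>
      real (Suc j) / lam * a j = (\<Sum>i = 1..Suc j. real (Suc j choose i) * (a (Suc j - i) * (fact i / mu ^ i)))"
  shows "(\<Sum>i\<le>k. real (k choose i) * (a (k - i) * (fact i / mu ^ i))) = fact k / (mu - lam) ^ k"
proof -
  define \<alpha> where "\<alpha> j = a j / fact j" for j
  define \<gamma> where "\<gamma> j = (\<Sum>i\<le>j. \<alpha> (j - i) / mu ^ i)" for j
  have mu: "0 < mu" using rates by simp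
  have term_eq: "real (n choose i) * (a (n - i) * (fact i / mu ^ i)) = fact n * (\<alpha> (n - i) / mu ^ i)"
    if "i \<le> n" for n i
    by (simp add: binomial_fact[OF that] \<alpha>_def)
  have \<gamma>_Suc: "\<gamma> (Suc j) = \<alpha> (Suc j) + \<gamma> j / mu" for j
    unfolding \<gamma>_def by (subst sum.atMost_Suc_shift) (simp add: sum_divide_distrib mult_ac)
  \<comment> \<open>These are the moments of the exponential law of rate \<open>mu - lam\<close>,
    divided by factorials.\<close>
  have "j \<le> k \<Longrightarrow> \<gamma> j = 1 / (mu - lam) ^ j" for j
  proof (induction j)
    case 0
    show ?case by (simp add: \<gamma>_def \<alpha>_def a0)
  next
    case (Suc j)
    let ?n = "Suc j"
    have "real (Suc ?n) / lam * a ?n =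
        (\<Sum>i = 1..Suc ?n. real (Suc ?n choose i) * (a (Suc ?n - i) * (fact i / mu ^ i)))"
      using Suc.prems by (intro rec) simp_all
    also have "\<dots> = (\<Sum>i = 1..Suc ?n. fact (Suc ?n) * (\<alpha> (Suc ?n - i) / mu ^ i))"
      by (intro sum.cong refl term_eq) simp
    also have "\<dots> = fact (Suc ?n) * (\<Sum>i = Suc 0..Suc ?n. \<alpha> (Suc ?n - i) / mu ^ i)"
      by (simp only: sum_distrib_left One_nat_def)
    \<comment> \<open>The sum starts at 1, so shifting the index splits off one factor
      \<open>1 / mu\<close> and leaves the full convolution.\<close>
    also have "(\<Sum>i = Suc 0..Suc ?n. \<alpha> (Suc ?n - i) / mu ^ i) = \<gamma> ?n / mu"
      unfolding sum.shift_bounds_cl_Suc_ivl \<gamma>_def atMost_atLeast0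
      by (simp add: sum_divide_distrib mult_ac del: sum.cl_ivl_Suc)
    finally have "real (Suc ?n) / lam * a ?n = real (Suc ?n) * (fact ?n * (\<gamma> ?n / mu))"
      by (simp only: fact_Suc of_nat_mult of_nat_fact mult.assoc)
    then have "a ?n / lam = fact ?n * (\<gamma> ?n / mu)"
      by (metis mult_left_cancel of_nat_0_eq_iff nat.distinct(2) times_divide_eq_left times_divide_eq_right)
    then have "\<alpha> ?n = lam * (\<gamma> ?n / mu)"
      using rates by (simp add: \<alpha>_def field_simps del: fact_Suc)
    \<comment> \<open>Eliminating \<open>\<alpha> ?n\<close> from the two relations makes
      \<open>\<gamma>\<close> a geometric sequence.\<close>
    with \<gamma>_Suc[of j] have "\<gamma> ?n * (mu - lam) = \<gamma> j"
      using mu by (simp add: field_simps)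
    then have "\<gamma> ?n = \<gamma> j / (mu - lam)" using rates by (simp add: nonzero_eq_divide_eq)
    with Suc show ?case by simp
  qed
  then have "\<gamma> k = 1 / (mu - lam) ^ k" by simp
  moreover have "(\<Sum>i\<le>k. real (k choose i) * (a (k - i) * (fact i / mu ^ i))) = fact k * \<gamma> k"
    unfolding \<gamma>_def sum_distrib_left by (intro sum.cong refl term_eq) simp
  ultimately show ?thesis by simp
qed

section \<open>From an invariant sojourn law to the balance equation\<close>

text \<open>On \<open>[0, d]\<close> the integrand, weighted by the density, is the derivative of
  \<open>- exp (- lam * t) * h (d - t)\<close>. The boundary value at \<open>t = d\<close> is 0 and
  the one at \<open>t = 0\<close> contributes \<open>h d\<close>.\<close>

lemma integral_exponential_smoothing:
  fixes h f :: "real \<Rightarrow> real"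
  assumes lam: "0 < lam" and d: "0 \<le> d"
    and deriv: "\<And>x. (h has_real_derivative f x) (at x)" and cont: "\<And>x. isCont f x"
    and zero: "h 0 = 0" "f 0 = 0"
  shows "(\<integral>t. h (max 0 (d - t)) + f (max 0 (d - t)) / lam \<partial>density lborel (exponential_density lam)) = h d"
proof -
  have ch: "isCont h x" for x using deriv by (rule DERIV_isCont)
  have [measurable]: "h \<in> borel_measurable borel" "f \<in> borel_measurable borel"
    using ch cont by (auto intro!: borel_measurable_continuous_onI continuous_at_imp_continuous_on)
  let ?g = "\<lambda>t. exp (- lam * t) * (lam * h (d - t) + f (d - t))"
  have "(\<integral>t. h (max 0 (d - t)) + f (max 0 (d - t)) / lam \<partial>density lborel (exponential_density lam)) =
      (\<integral>t. exponential_density lam t *\<^sub>R (h (max 0 (d - t)) + f (max 0 (d - t)) / lam) \<partial>lborel)"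
    using lam by (intro integral_density) auto
  \<comment> \<open>The density vanishes for \<open>t < 0\<close>; for \<open>t > d\<close> the
    maximum is 0, where \<open>h\<close> and \<open>f\<close> vanish.\<close>
  also have "\<dots> = (\<integral>t. ?g t * indicator {0..d} t \<partial>lborel)"
    using lam zero
    by (intro Bochner_Integration.integral_cong refl)
      (auto simp: exponential_density_def indicator_def max_def field_simps)
  also have "\<dots> = (- exp (- lam * d) * h (d - d)) - (- exp (- lam * 0) * h (d - 0))"
  proof (rule integral_FTC_Icc_real[OF d])
    fix x
    have "((\<lambda>x. h (d - x)) has_real_derivative f (d - x) * (- 1)) (at x)"
      by (rule DERIV_chain2[where f = h, OF deriv]) (auto intro!: derivative_eq_intros)
    then show "((\<lambda>x. - exp (- lam * x) * h (d - x)) has_real_derivative ?g x) (at x)"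
      by (auto intro!: derivative_eq_intros simp: algebra_simps)
    show "isCont ?g x"
      by (intro continuous_intros isCont_o2[OF _ ch] isCont_o2[OF _ cont])
  qed
  also have "\<dots> = h d" using zero by simp
  finally show ?thesis .
qed

text \<open>Tonelli's theorem regroups one step: invariance is obtained with the pair (interarrival
  time, service time) as innovation, whereas the moment recursion needs the waiting law times the
  service law.\<close>

lemma distr_lindley_step_assoc:
  fixes Q E B :: "real measure"
  assumes prob: "prob_space Q" "prob_space E" "prob_space B"
    and sets [measurable_cong]: "sets Q = sets borel" "sets E = sets borel" "sets B = sets borel"
  shows "distr (distr (Q \<Otimes>\<^sub>M E) borel (\<lambda>z. max 0 (fst z - snd z)) \<Otimes>\<^sub>M B) borel (\<lambda>z. fst z + snd z) =
    distr (Q \<Otimes>\<^sub>M (E \<Otimes>\<^sub>M B)) borel (\<lambda>z. max 0 (fst z - fst (snd z)) + snd (snd z))"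
    (is "distr (?N \<Otimes>\<^sub>M B) borel _ = _")
proof (rule measure_eqI)
  interpret E: prob_space E by fact
  interpret B: prob_space B by fact
  interpret EB: pair_prob_space E B ..
  fix A assume "A \<in> sets (distr (?N \<Otimes>\<^sub>M B) borel (\<lambda>z. fst z + snd z))"
  then have [measurable]: "A \<in> sets borel" by simp
  have "emeasure (distr (?N \<Otimes>\<^sub>M B) borel (\<lambda>z. fst z + snd z)) A =
      (\<integral>\<^sup>+z. indicator A (fst z + snd z) \<partial>(?N \<Otimes>\<^sub>M B))"
    by (subst nn_integral_indicator[symmetric], simp, subst nn_integral_distr) measurable
  also have "\<dots> = (\<integral>\<^sup>+d. \<integral>\<^sup>+t. \<integral>\<^sup>+s. indicator A (max 0 (d - t) + s) \<partial>B \<partial>E \<partial>Q)"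
    by (simp add: B.nn_integral_fst[symmetric] nn_integral_distr E.nn_integral_fst[symmetric])
  also have "\<dots> = emeasure (distr (Q \<Otimes>\<^sub>M (E \<Otimes>\<^sub>M B)) borel
      (\<lambda>z. max 0 (fst z - fst (snd z)) + snd (snd z))) A"
    by (subst nn_integral_indicator[symmetric], simp, subst nn_integral_distr, measurable)
      (simp add: EB.nn_integral_fst[symmetric] B.nn_integral_fst[symmetric])
  finally show "emeasure (distr (?N \<Otimes>\<^sub>M B) borel (\<lambda>z. fst z + snd z)) A = \<dots>" .
qed simp

text \<open>Integrating out the interarrival time by \<open>integral_exponential_smoothing\<close>
  turns the left side of \<open>balance\<close> into the integral of \<open>h\<close> against
  \<open>Q\<close>, and \<open>Q_eq\<close> rewrites \<open>Q\<close> as the law of W + S.\<close>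

lemma stationary_waiting_lawI:
  fixes Q B :: "real measure" and lam :: real
  defines "N \<equiv> distr (Q \<Otimes>\<^sub>M density lborel (exponential_density lam)) borel (\<lambda>z. max 0 (fst z - snd z))"
  assumes lam: "0 < lam" and Q: "real_distribution Q" and B: "real_distribution B"
    and nonneg: "AE s in B. 0 \<le> s"
    and Q_eq: "Q = distr (N \<Otimes>\<^sub>M B) borel (\<lambda>z. fst z + snd z)"
  shows "stationary_waiting_law N B lam"
proof -
  let ?E = "density lborel (exponential_density lam)"
  interpret Q: real_distribution Q by fact
  interpret B: real_distribution B by fact
  interpret E: prob_space ?E by (rule prob_space_exponential_density[OF lam])
  interpret QE: pair_prob_space Q ?E ..
  have E_sets [measurable_cong]: "sets ?E = sets borel" by simp
  interpret N: prob_space N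
    unfolding N_def by (rule QE.prob_space_distr) measurable
  interpret NB: pair_prob_space N B ..
  have [measurable_cong]: "sets N = sets borel" by (simp add: N_def)
  have N_nonneg: "AE w in N. 0 \<le> w"
    unfolding N_def by (subst AE_distr_iff) auto
  \<comment> \<open>The fixed-point equation itself confines \<open>Q\<close> to the half-line on
    which the smoothing lemma holds.\<close>
  have Q_nonneg: "AE d in Q. 0 \<le> d"
  proof -
    have "AE z in N \<Otimes>\<^sub>M B. 0 \<le> fst z + snd z"
    proof (rule NB.AE_pair_measure)
      show "AE x in N. AE y in B. 0 \<le> fst (x, y) + snd (x, y)"
        using N_nonneg by eventually_elim (use nonneg in \<open>auto elim!: eventually_mono\<close>)
    qed measurable
    then show ?thesis by (subst Q_eq, subst AE_distr_iff) auto
  qed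
  show ?thesis
  proof unfold_locales
    fix h f :: "real \<Rightarrow> real" and C :: real
    assume deriv: "\<And>x. (h has_real_derivative f x) (at x)" and cont: "\<And>x. isCont f x"
      and zero: "h 0 = 0" "f 0 = 0"
      and bounds: "\<And>x. 0 \<le> x \<Longrightarrow> \<bar>h x\<bar> \<le> C" "\<And>x. 0 \<le> x \<Longrightarrow> \<bar>f x\<bar> \<le> C"
    have ch: "isCont h x" for x using deriv by (rule DERIV_isCont)
    have [measurable]: "h \<in> borel_measurable borel" "f \<in> borel_measurable borel"
      using ch cont by (auto intro!: borel_measurable_continuous_onI continuous_at_imp_continuous_on)
    let ?F = "\<lambda>w. h w + f w / lam"
    have "\<bar>?F w\<bar> \<le> C + C / lam" if "0 \<le> w" for w
    proof -
      have "\<bar>f w / lam\<bar> \<le> C / lam" using bounds(2)[OF that] lam by (simp add: divide_right_mono)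
      with bounds(1)[OF that] show ?thesis by linarith
    qed
    then have int: "integrable (Q \<Otimes>\<^sub>M ?E) (\<lambda>z. ?F (max 0 (fst z - snd z)))"
      by (intro QE.integrable_const_bound[where B = "C + C / lam"]) auto
    have "(\<integral>w. ?F w \<partial>N) = (\<integral>z. ?F (max 0 (fst z - snd z)) \<partial>(Q \<Otimes>\<^sub>M ?E))"
      unfolding N_def by (rule integral_distr) measurable
    also have "\<dots> = (\<integral>d. (\<integral>t. ?F (max 0 (d - t)) \<partial>?E) \<partial>Q)"
      by (subst QE.integral_fst'[OF int, symmetric]) simp
    also have "\<dots> = (\<integral>d. h d \<partial>Q)"
    proof (rule integral_cong_AE)
      show "AE d in Q. (\<integral>t. ?F (max 0 (d - t)) \<partial>?E) = h d"
        using Q_nonneg by eventually_elim (rule integral_exponential_smoothing[OF lam _ deriv cont zero])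
    qed measurable
    also have "\<dots> = (\<integral>z. h (fst z + snd z) \<partial>(N \<Otimes>\<^sub>M B))"
      by (subst Q_eq, rule integral_distr) measurable
    finally show "(\<integral>w. ?F w \<partial>N) = (\<integral>z. h (fst z + snd z) \<partial>(N \<Otimes>\<^sub>M B))" .
  qed (use lam N_nonneg nonneg in \<open>simp_all add: N_def\<close>)
qed

section \<open>The sojourn times of the queue as a Markov chain\<close>

text \<open>In this form of the Lindley recursion the interarrival and service times enter with the
  same index, so the innovations of different steps are disjoint pairs.\<close>

lemma sojourn_time_Suc:
  "sojourn_time t v (Suc n) = max 0 (sojourn_time t v n - t (Suc n)) + v (Suc n)"
  by (simp add: sojourn_time_def waiting_time_lindley)

lemma sojourn_time_0: "sojourn_time t v 0 = v 0"
  by (simp add: sojourn_time_def waiting_time_lindley)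

lemma sojourn_time_cong:
  "(\<And>i. i \<le> n \<Longrightarrow> t i = t' i) \<Longrightarrow> (\<And>i. i \<le> n \<Longrightarrow> v i = v' i) \<Longrightarrow> sojourn_time t v n = sojourn_time t' v' n"
  by (induction n) (auto simp: sojourn_time_Suc sojourn_time_0)

lemma sojourn_time_measurable:
  "(\<And>i. i \<le> n \<Longrightarrow> (\<lambda>x. t x i) \<in> borel_measurable A) \<Longrightarrow>
   (\<And>i. i \<le> n \<Longrightarrow> (\<lambda>x. v x i) \<in> borel_measurable A) \<Longrightarrow>
   (\<lambda>x. sojourn_time (t x) (v x) n) \<in> borel_measurable A"
  by (induction n) (auto simp: sojourn_time_Suc sojourn_time_0)

context MG1_queue
begin

abbreviation sojourn :: "nat \<Rightarrow> 'a \<Rightarrow> real" where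
  "sojourn n \<equiv> \<lambda>\<omega>. sojourn_time (\<lambda>i. T i \<omega>) (\<lambda>i. V i \<omega>) n"

lemma T_measurable: "T n \<in> borel_measurable M"
  using distributed_measurable[OF interarrival] by simp

lemma distr_T: "distr M borel (T n) = density lborel (exponential_density lam)"
  using distributed_distr_eq_density[OF interarrival, of n] distr_cong[of M M borel lborel "T n" "T n"]
  by simp

lemma sojourn_measurable: "sojourn n \<in> borel_measurable M"
  by (intro sojourn_time_measurable T_measurable services_measurable)

text \<open>Independence is used twice: between the inputs up to index \<open>n\<close> and the next
  pair, and inside that pair. The resulting transition does not depend on \<open>n\<close>.\<close>

lemma distr_sojourn_Suc:
  "distr M borel (sojourn (Suc n)) =
    distr (distr M borel (sojourn n) \<Otimes>\<^sub>M
        (density lborel (exponential_density lam) \<Otimes>\<^sub>M distr M borel S)) borel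
      (\<lambda>z. max 0 (fst z - fst (snd z)) + snd (snd z))"
proof -
  note [measurable] = T_measurable services_measurable sojourn_measurable
  let ?X = "case_sum T V" and ?A = "Inl ` {..n} \<union> Inr ` {..n} :: (nat + nat) set"
    and ?B = "{Inl (Suc n), Inr (Suc n)} :: (nat + nat) set"
  let ?Y = "\<lambda>x. sojourn_time (\<lambda>i. x (Inl i)) (\<lambda>i. x (Inr i)) n"
  let ?Z = "\<lambda>x. (x (Inl (Suc n)), x (Inr (Suc n)))"
  have "indep_var (PiM ?A (\<lambda>_. borel)) (\<lambda>\<omega>. restrict (\<lambda>i. ?X i \<omega>) ?A)
      (PiM ?B (\<lambda>_. borel)) (\<lambda>\<omega>. restrict (\<lambda>i. ?X i \<omega>) ?B)"
    by (rule indep_var_restrict[OF independent]) auto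
  then have "distr M borel (\<lambda>\<omega>. ?Y (restrict (\<lambda>i. ?X i \<omega>) ?A)) \<Otimes>\<^sub>M
        distr M (borel \<Otimes>\<^sub>M borel) (\<lambda>\<omega>. ?Z (restrict (\<lambda>i. ?X i \<omega>) ?B)) =
      distr M (borel \<Otimes>\<^sub>M (borel \<Otimes>\<^sub>M borel))
        (\<lambda>\<omega>. (?Y (restrict (\<lambda>i. ?X i \<omega>) ?A), ?Z (restrict (\<lambda>i. ?X i \<omega>) ?B)))"
    by (rule distr_indep_pair)
      (auto intro!: sojourn_time_measurable measurable_component_singleton measurable_Pair)
  \<comment> \<open>Outside \<open>?A\<close> the restriction is \<open>undefined\<close>, but
    \<open>sojourn_time\<close> at \<open>n\<close> reads only indices up to
    \<open>n\<close>.\<close>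
  moreover have "?Y (restrict (\<lambda>i. ?X i \<omega>) ?A) = sojourn n \<omega>" for \<omega>
    by (auto intro!: sojourn_time_cong)
  moreover have "?Z (restrict (\<lambda>i. ?X i \<omega>) ?B) = (T (Suc n) \<omega>, V (Suc n) \<omega>)" for \<omega>
    by auto
  ultimately have past: "distr M borel (sojourn n) \<Otimes>\<^sub>M
        distr M (borel \<Otimes>\<^sub>M borel) (\<lambda>\<omega>. (T (Suc n) \<omega>, V (Suc n) \<omega>)) =
      distr M (borel \<Otimes>\<^sub>M (borel \<Otimes>\<^sub>M borel)) (\<lambda>\<omega>. (sojourn n \<omega>, (T (Suc n) \<omega>, V (Suc n) \<omega>)))"
    by (simp only:)
  have "indep_var (PiM {Inl (Suc n)} (\<lambda>_. borel)) (\<lambda>\<omega>. restrict (\<lambda>i. ?X i \<omega>) {Inl (Suc n)})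
      (PiM {Inr (Suc n)} (\<lambda>_. borel)) (\<lambda>\<omega>. restrict (\<lambda>i. ?X i \<omega>) {Inr (Suc n)})"
    by (rule indep_var_restrict[OF independent]) auto
  then have "indep_var borel ((\<lambda>x. x (Inl (Suc n))) \<circ> (\<lambda>\<omega>. restrict (\<lambda>i. ?X i \<omega>) {Inl (Suc n)}))
      borel ((\<lambda>x. x (Inr (Suc n))) \<circ> (\<lambda>\<omega>. restrict (\<lambda>i. ?X i \<omega>) {Inr (Suc n)}))"
    by (rule indep_var_compose) (auto intro!: measurable_component_singleton)
  then have "indep_var borel (T (Suc n)) borel (V (Suc n))"
    by (simp add: comp_def)
  then have "distr M (borel \<Otimes>\<^sub>M borel) (\<lambda>\<omega>. (T (Suc n) \<omega>, V (Suc n) \<omega>)) =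
      density lborel (exponential_density lam) \<Otimes>\<^sub>M distr M borel S"
    unfolding indep_var_distribution_eq by (simp add: distr_T services_distr)
  then have "distr M borel (sojourn n) \<Otimes>\<^sub>M
        (density lborel (exponential_density lam) \<Otimes>\<^sub>M distr M borel S) =
      distr M (borel \<Otimes>\<^sub>M (borel \<Otimes>\<^sub>M borel)) (\<lambda>\<omega>. (sojourn n \<omega>, (T (Suc n) \<omega>, V (Suc n) \<omega>)))"
    using past by simp
  then show ?thesis
    by (simp add: distr_distr comp_def sojourn_time_Suc)
qed

theorem steady_state_law:
  assumes D: "steady_state_sojourn_time M T V D"
  obtains N where "stationary_waiting_law N (distr M borel S) lam"
    "distr M borel D = distr (N \<Otimes>\<^sub>M distr M borel S) borel (\<lambda>z. fst z + snd z)"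
proof -
  let ?Q = "distr M borel D" and ?B = "distr M borel S"
  let ?E = "density lborel (exponential_density lam)"
  let ?N = "distr (?Q \<Otimes>\<^sub>M ?E) borel (\<lambda>z. max 0 (fst z - snd z))"
  note [measurable] = service_measurable
  have Dm: "D \<in> borel_measurable M"
    and lim: "weak_conv_m (\<lambda>n. distr M borel (sojourn n)) ?Q"
    using D by (auto simp: steady_state_sojourn_time_def)
  interpret E: prob_space ?E by (rule prob_space_exponential_density[OF rate_pos])
  interpret B: real_distribution ?B by (rule real_distribution_distr) measurable
  interpret EB: pair_prob_space ?E ?B ..
  have Q: "real_distribution ?Q" using Dm by (rule real_distribution_distr)
  then interpret Q: real_distribution ?Q .
  have "?Q = distr (?Q \<Otimes>\<^sub>M (?E \<Otimes>\<^sub>M ?B)) borel (\<lambda>z. max 0 (fst z - fst (snd z)) + snd (snd z))"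
  proof (rule weak_limit_of_chain_stationary[OF _ Q _ lim _ _ distr_sojourn_Suc])
    show "real_distribution (distr M borel (sojourn n))" for n
      by (intro real_distribution_distr sojourn_measurable)
    show "prob_space (?E \<Otimes>\<^sub>M ?B)" by (rule EB.prob_space_axioms)
    show "isCont (\<lambda>x. max 0 (fst (x, y) - fst (snd (x, y))) + snd (snd (x, y))) x"
      for x :: real and y :: "real \<times> real"
      by (auto intro!: continuous_intros)
  qed measurable
  also have "\<dots> = distr (?N \<Otimes>\<^sub>M ?B) borel (\<lambda>z. fst z + snd z)"
    by (rule distr_lindley_step_assoc[symmetric]) (unfold_locales, simp_all)
  finally have eq: "?Q = distr (?N \<Otimes>\<^sub>M ?B) borel (\<lambda>z. fst z + snd z)" .
  have "AE s in ?B. 0 \<le> s"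
    using service_nonneg by (subst AE_distr_iff) auto
  then have "stationary_waiting_law ?N ?B lam"
    using eq by (intro stationary_waiting_lawI rate_pos Q B.real_distribution_axioms)
  then show thesis using eq by (rule that)
qed

end

section \<open>Moments of the scaled steady-state sojourn time\<close>

theorem corollary2:
  fixes M :: "'a measure" and T V :: "nat \<Rightarrow> 'a \<Rightarrow> real" and S D Z :: "'a \<Rightarrow> real"
    and lam mu rho eps C1 :: real and g :: "real \<Rightarrow> real" and k :: nat
  assumes k: "2 \<le> k"
    and queue: "MG1_queue M lam T V S"
    and D: "steady_state_sojourn_time M T V D"
    and rho: "rho = lam * (\<integral>\<omega>. S \<omega> \<partial>M)" "rho < 1"
    and eps: "eps = 1 - rho"
    and mu: "0 < mu"
    and Z: "distributed M lborel Z (exponential_density mu)"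
    and g_density: "distributed M lborel S (\<lambda>y. ennreal (g y))"
    and g_nonneg: "\<And>y. 0 \<le> g y"
    and g_support: "\<And>y. y < 0 \<Longrightarrow> g y = 0"
    and g_diff: "\<And>y. 0 < y \<Longrightarrow> g differentiable (at y)"
    and g_lim: "(g \<longlongrightarrow> 0) at_top"
    and C1_integrable: "set_integrable lborel {0<..} (\<lambda>y. y ^ k * (deriv g y + mu * g y))"
    and C1_bound: "(LBINT y:{0<..}. \<bar>y ^ k * (deriv g y + mu * g y)\<bar>) \<le> C1"
    and moments: "\<And>i. 1 \<le> i \<Longrightarrow> i \<le> k + 1 \<Longrightarrow> (\<integral>\<omega>. S \<omega> ^ i \<partial>M) = (\<integral>\<omega>. Z \<omega> ^ i \<partial>M)"
  shows "integrable M (\<lambda>\<omega>. (eps * D \<omega>) ^ k) \<and>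
    ennreal \<bar>(\<integral>\<omega>. (eps * D \<omega>) ^ k \<partial>M) - fact k / mu ^ k\<bar>
      \<le> C2_bound M S lam mu k C1 * ennreal (fact k * eps ^ k)"
proof -
  interpret MG1_queue M lam T V S by (rule queue)
  note [measurable] = service_measurable
  have Dm [measurable]: "D \<in> borel_measurable M"
    using D by (simp add: steady_state_sojourn_time_def)
  let ?B = "distr M borel S"
  obtain N where N: "stationary_waiting_law N ?B lam"
    and D_law: "distr M borel D = distr (N \<Otimes>\<^sub>M ?B) borel (\<lambda>z. fst z + snd z)"
    using D by (rule steady_state_law)
  interpret L: stationary_waiting_law N ?B lam by (rule N)
  \<comment> \<open>An exponential law is an Erlang law of parameter 0; the case
    \<open>i = 0\<close> is the total mass 1.\<close>
  have S_moment: "(\<integral>\<omega>. S \<omega> ^ i \<partial>M) = fact i / mu ^ i" if "i \<le> k + 1" for i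
    using that moments[of i] erlang_ith_moment[OF mu Z, of i] by (cases "i = 0") (auto simp: prob_space)
  \<comment> \<open>The integral of a non-integrable function is 0 by convention, whereas these
    moments are positive.\<close>
  have "integrable M (\<lambda>\<omega>. S \<omega> ^ i)" if "i \<le> k + 1" for i
    using S_moment[OF that] mu not_integrable_integral_eq[of M "\<lambda>\<omega>. S \<omega> ^ i"] by fastforce
  then have B_int: "integrable ?B (\<lambda>s. s ^ i)" if "i \<le> Suc k" for i
    using that by (simp add: integrable_distr_eq)
  have B_moment: "(\<integral>s. s ^ i \<partial>?B) = fact i / mu ^ i" if "i \<le> Suc k" for i
    using that S_moment[of i] by (simp add: integral_distr)
  have mean: "(\<integral>s. s \<partial>?B) = 1 / mu" using B_moment[of 1] by simp
  have rho_eq: "rho = lam / mu" using rho(1) mean by (simp add: integral_distr)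
  have lam_mu: "lam < mu" using rho(2) mu unfolding rho_eq by simp
  have load: "lam * (\<integral>s. s \<partial>?B) < 1" using rho(2) rho_eq mean by simp
  have "(\<Sum>i\<le>k. real (k choose i) * ((\<integral>w. w ^ (k - i) \<partial>N) * (fact i / mu ^ i))) = fact k / (mu - lam) ^ k"
  proof (rule exponential_service_recursion_solution[OF rate_pos lam_mu])
    show "(\<integral>w. w ^ 0 \<partial>N) = 1" by (simp add: L.M1.prob_space)
    fix j assume j: "1 \<le> j" "j \<le> k"
    have "real (Suc j) / lam * (\<integral>w. w ^ j \<partial>N) =
      (\<Sum>i = 1..Suc j. real (Suc j choose i) * ((\<integral>w. w ^ (Suc j - i) \<partial>N) * (\<integral>s. s ^ i \<partial>?B)))"
      by (rule L.waiting_moment_recursion[OF B_int load j])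
    also have "\<dots> =
      (\<Sum>i = 1..Suc j. real (Suc j choose i) * ((\<integral>w. w ^ (Suc j - i) \<partial>N) * (fact i / mu ^ i)))"
      using j by (intro sum.cong refl) (simp add: B_moment)
    finally show "real (Suc j) / lam * (\<integral>w. w ^ j \<partial>N) = \<dots>" .
  qed
  then have "(\<integral>z. (fst z + snd z) ^ k \<partial>(N \<Otimes>\<^sub>M ?B)) = fact k / (mu - lam) ^ k"
    by (simp add: L.sojourn_moment(2)[OF B_int load] B_moment)
  then have D_moment: "(\<integral>\<omega>. D \<omega> ^ k \<partial>M) = fact k / (mu - lam) ^ k"
    using arg_cong[OF D_law, of "\<lambda>P. \<integral>x. x ^ k \<partial>P"] by (simp add: integral_distr)
  have D_int: "integrable M (\<lambda>\<omega>. D \<omega> ^ k)"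
    using arg_cong[OF D_law, of "\<lambda>P. integrable P (\<lambda>x. x ^ k)"] L.sojourn_moment(1)[OF B_int load]
    by (simp add: integrable_distr_eq)
  \<comment> \<open>Scaling by \<open>eps\<close> takes the rate \<open>mu - lam\<close> to
    \<open>mu\<close>, so the difference is 0, the least element of \<open>ennreal\<close>.\<close>
  have "eps = (mu - lam) / mu" using eps rho_eq mu by (simp add: field_simps)
  then have "(\<integral>\<omega>. (eps * D \<omega>) ^ k \<partial>M) = fact k / mu ^ k"
    using D_moment lam_mu by (simp add: power_mult_distrib power_divide)
  with D_int show ?thesis by (simp add: power_mult_distrib)
qed

end
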